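(* Let $\Gamma$ be a group that is nilpotent of class $\le n$, let $S\subseteq\Gamma\setminus\{\mathbb{I}\}$ be a generating set, $G:=\mathrm{Cay}(\Gamma,S)$, and let $r\ge\max\{2^{n+2},10\}$ be an integer. Let $h\in S$ be such that $\{\mathbb{I},h\}$ is an $r$-local $2$-separator of $G$, and suppose that $G$ has no $r$-local cutvertex. If $h$ is an involution, then the subgroup of $\Gamma$ generated by $h$ is normal.
   Context: Generating sets are closed under inverses; $\mathrm{Cay}(\Gamma,S)$ is the simple graph on $\Gamma$ with edges $\{g,gs\}$. $a\equiv b$ means $a=b$ or $a=b^{-1}$; $\Gamma$ is nilpotent of class $\le n$ if $[g,h]_n=\mathbb{I}$ for all $g\not\equiv h$, where $[g,h]_1=gh^{-1}g^{-1}h$ and $[g,h]_n$ is the reduced form of $g[g,h]_{n-1}^{-1}g^{-1}[g,h]_{n-1}$. Ball $B_r(v)$: subgraph of all vertices and edges on closed walks of length $\le r$ through $v$; $v$ is an $r$-local cutvertex if $B_r(v)-v$ is disconnected. For $X=\{v_0,v_1\}$, $N(X)$ is the set of vertices outside $X$ adjacent to $X$; the connectivity graph $C_r(v_0,v_1)$ has vertex set $N(X)$, $a,b$ adjacent if for some $i$ they lie in the same component of $B_r(v_i)-v_0-v_1$; $X$ is an $r$-local $2$-separator if $C_r(v_0,v_1)$ is disconnected and $d_G(v_0,v_1)\le r/2$. *)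

theory Defs
  imports "HOL-Algebra.Algebra"
begin

primrec itcomm :: "('a, 'b) monoid_scheme \<Rightarrow> 'a \<Rightarrow> 'a \<Rightarrow> nat \<Rightarrow> 'a" where
  "itcomm G g h 0 = h"
| "itcomm G g h (Suc k) =
     g \<otimes>\<^bsub>G\<^esub> inv\<^bsub>G\<^esub> (itcomm G g h k) \<otimes>\<^bsub>G\<^esub> inv\<^bsub>G\<^esub> g \<otimes>\<^bsub>G\<^esub> itcomm G g h k"

definition nilpotent_le :: "('a, 'b) monoid_scheme \<Rightarrow> nat \<Rightarrow> bool" where
  "nilpotent_le G n \<longleftrightarrow>
     (\<forall>g \<in> carrier G. \<forall>h \<in> carrier G.
        (g \<noteq> h \<and> g \<noteq> inv\<^bsub>G\<^esub> h) \<longrightarrow> itcomm G g h n = \<one>\<^bsub>G\<^esub>)"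

definition cay_adj :: "('a, 'b) monoid_scheme \<Rightarrow> 'a set \<Rightarrow> 'a \<Rightarrow> 'a \<Rightarrow> bool" where
  "cay_adj G S u w \<longleftrightarrow> u \<in> carrier G \<and> w \<in> carrier G \<and> (\<exists>s\<in>S. w = u \<otimes>\<^bsub>G\<^esub> s)"

text \<open>A walk is a nonempty vertex list with consecutive entries adjacent;
 its length is length xs - 1.\<close>
definition is_walk :: "('a \<Rightarrow> 'a \<Rightarrow> bool) \<Rightarrow> 'a list \<Rightarrow> bool" where
  "is_walk E xs \<longleftrightarrow> xs \<noteq> [] \<and> (\<forall>i. Suc i < length xs \<longrightarrow> E (xs ! i) (xs ! Suc i))"

definition closed_walk_through :: "('a \<Rightarrow> 'a \<Rightarrow> bool) \<Rightarrow> nat \<Rightarrow> 'a \<Rightarrow> 'a list \<Rightarrow> bool" where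
  "closed_walk_through E r v xs \<longleftrightarrow>
     is_walk E xs \<and> hd xs = last xs \<and> length xs \<le> Suc r \<and> v \<in> set xs"

definition ball_verts :: "('a \<Rightarrow> 'a \<Rightarrow> bool) \<Rightarrow> nat \<Rightarrow> 'a \<Rightarrow> 'a set" where
  "ball_verts E r v = {x. \<exists>xs. closed_walk_through E r v xs \<and> x \<in> set xs}"

definition ball_edges :: "('a \<Rightarrow> 'a \<Rightarrow> bool) \<Rightarrow> nat \<Rightarrow> 'a \<Rightarrow> 'a set set" where
  "ball_edges E r v = {{xs ! i, xs ! Suc i} | xs i. closed_walk_through E r v xs \<and> Suc i < length xs}"

definition ball_minus_adj :: "('a \<Rightarrow> 'a \<Rightarrow> bool) \<Rightarrow> nat \<Rightarrow> 'a \<Rightarrow> 'a set \<Rightarrow> 'a \<Rightarrow> 'a \<Rightarrow> bool" where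
  "ball_minus_adj E r v Z a b \<longleftrightarrow> {a, b} \<in> ball_edges E r v \<and> a \<notin> Z \<and> b \<notin> Z"

definition same_comp :: "('a \<Rightarrow> 'a \<Rightarrow> bool) \<Rightarrow> nat \<Rightarrow> 'a \<Rightarrow> 'a set \<Rightarrow> 'a \<Rightarrow> 'a \<Rightarrow> bool" where
  "same_comp E r v Z a b \<longleftrightarrow>
     a \<in> ball_verts E r v - Z \<and> b \<in> ball_verts E r v - Z \<and> rtranclp (ball_minus_adj E r v Z) a b"

definition local_cutvertex :: "('a \<Rightarrow> 'a \<Rightarrow> bool) \<Rightarrow> nat \<Rightarrow> 'a \<Rightarrow> bool" where
  "local_cutvertex E r v \<longleftrightarrow>
     (\<exists>a b. a \<in> ball_verts E r v - {v} \<and> b \<in> ball_verts E r v - {v} \<and>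
            \<not> same_comp E r v {v} a b)"

definition nbhd :: "('a \<Rightarrow> 'a \<Rightarrow> bool) \<Rightarrow> 'a set \<Rightarrow> 'a set" where
  "nbhd E Y = {a. a \<notin> Y \<and> (\<exists>y\<in>Y. E y a)}"

definition conn_adj :: "('a \<Rightarrow> 'a \<Rightarrow> bool) \<Rightarrow> nat \<Rightarrow> 'a \<Rightarrow> 'a \<Rightarrow> 'a \<Rightarrow> 'a \<Rightarrow> bool" where
  "conn_adj E r v0 v1 a b \<longleftrightarrow>
     a \<in> nbhd E {v0, v1} \<and> b \<in> nbhd E {v0, v1} \<and>
     (same_comp E r v0 {v0, v1} a b \<or> same_comp E r v1 {v0, v1} a b)"

definition dist_le_half :: "('a \<Rightarrow> 'a \<Rightarrow> bool) \<Rightarrow> nat \<Rightarrow> 'a \<Rightarrow> 'a \<Rightarrow> bool" where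
  "dist_le_half E r v0 v1 \<longleftrightarrow>
     (\<exists>xs. is_walk E xs \<and> hd xs = v0 \<and> last xs = v1 \<and> 2 * (length xs - 1) \<le> r)"

definition local_2_separator :: "('a \<Rightarrow> 'a \<Rightarrow> bool) \<Rightarrow> nat \<Rightarrow> 'a \<Rightarrow> 'a \<Rightarrow> bool" where
  "local_2_separator E r v0 v1 \<longleftrightarrow>
     v0 \<noteq> v1 \<and>
     (\<exists>a \<in> nbhd E {v0, v1}. \<exists>b \<in> nbhd E {v0, v1}. \<not> rtranclp (conn_adj E r v0 v1) a b) \<and>
     dist_le_half E r v0 v1"

end

theory Submission
  imports Defs
begin

text \<open>
  Since \<open>h\<close> is an involution, the translates of \<open>{\<one>, h}\<close> are the left cosets of \<open>\<langle>h\<rangle>\<close>, and each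
  of them is a local 2-separator. Follow a closed walk of length at most \<open>r\<close> through the cosets and
  say that it crosses a coset when it enters from one side and leaves to the other, where a side is
  a union of components of the connectivity graph or its complement. The two vertices of a coset
  lie on the same side of every other coset, so crossings of different cosets do not interlace; an
  innermost pair of crossings of one coset therefore has no crossing in between, and the part of
  the word between them lies in \<open>{\<one>, h}\<close>.

  As \<open>h\<close> inverts \<open>[h, y]\<^sub>1\<close>, nilpotency says that \<open>[h, y]\<^sub>1\<close> has order dividing \<open>2\<^sup>n\<^sup>-\<^sup>1\<close>, which gives a
  closed walk of length at most \<open>2\<^sup>n\<^sup>+\<^sup>2\<close> for every product \<open>y\<close> of at most three generators. Write
  \<open>~\<close> for connectedness in the connectivity graph. The walk for \<open>y = g\<close> yields \<open>g ~ h g\<close>, and the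
  one for \<open>y = inv a b\<close> yields \<open>a ~ b\<close> unless \<open>a\<close> or \<open>b\<close> commutes with \<open>h\<close>. Hence, if \<open>g\<close> does not
  commute with \<open>h\<close>, every generator \<open>x\<close> outside its component commutes with \<open>h\<close>, and the walk for
  \<open>y = g x inv g\<close> gives a contradiction. So \<open>h\<close> is central.
\<close>

section \<open>Crossings of cyclic sequences\<close>

locale crossing_sequence =
  fixes block :: "nat \<Rightarrow> 'c" and side :: "nat \<Rightarrow> nat \<Rightarrow> bool"
    and crossing :: "nat \<Rightarrow> bool" and m :: nat
  assumes block_Suc: "block (Suc i) \<noteq> block i"
    and side_Suc: "block i \<noteq> block k \<Longrightarrow> block (Suc i) \<noteq> block k \<Longrightarrow> side k i = side k (Suc i)"
    and side_block: "block i = block j \<Longrightarrow> block i \<noteq> block k \<Longrightarrow> side k i = side k j"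
    and crossing_iff: "block (Suc i) = block k \<Longrightarrow> crossing i \<longleftrightarrow> side k i \<noteq> side k (Suc (Suc i))"
    and block_period: "block (i + m) = block i"
    and crossing_period: "crossing (i + m) = crossing i"
    and period_pos: "0 < m"
begin

lemma side_constant_without_crossing:
  assumes "a \<le> b" "block a \<noteq> block k" "block b \<noteq> block k"
    and "\<And>t. a \<le> t \<Longrightarrow> Suc t < b \<Longrightarrow> block (Suc t) = block k \<Longrightarrow> \<not> crossing t"
  shows "side k a = side k b"
  using assms
proof (induction b rule: less_induct)
  case (less b)
  show ?case
  proof (cases "a = b")
    case False
    then obtain b' where b: "b = Suc b'" "a \<le> b'" using less.prems(1) by (cases b) auto
    show ?thesis
    proof (cases "block b' = block k")
      case False
      have "side k a = side k b'" by (rule less.IH) (use less.prems b False in auto)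
      then show ?thesis using side_Suc less.prems(3) b(1) False by simp
    next
      case True
      then obtain b'' where b': "b' = Suc b''" "a \<le> b''"
        using b less.prems(2) by (cases b') (auto simp: le_Suc_eq)
      have "side k a = side k b''"
        by (rule less.IH) (use less.prems b b' True block_Suc[of b''] in auto)
      moreover have "\<not> crossing b''" using less.prems(4) b b' True by simp
      ultimately show ?thesis using crossing_iff[of b'' k] True b(1) b'(1) by simp
    qed
  qed simp
qed

text \<open>Between two visits to one block, every other block is crossed an even number of times.\<close>

lemma other_crossing_of_block:
  assumes "i < k" "k < j" "crossing k"
    and "block (Suc i) = block (Suc j)" "block (Suc k) \<noteq> block (Suc i)"
  obtains t where "i < t" "t < j" "t \<noteq> k" "crossing t" "block (Suc t) = block (Suc k)"
proof (rule ccontr)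
  note witness = that
  assume "\<not> thesis"
  then have only: "\<not> crossing t" if "i < t" "t < j" "t \<noteq> k" "block (Suc t) = block (Suc k)" for t
    using witness that by blast
  have "side (Suc k) (Suc i) = side (Suc k) k"
    by (rule side_constant_without_crossing) (use assms block_Suc[of k] only in auto)
  moreover have "side (Suc k) (Suc (Suc k)) = side (Suc k) (Suc j)"
    by (rule side_constant_without_crossing) (use assms block_Suc[of "Suc k"] only in auto)
  moreover have "side (Suc k) (Suc i) = side (Suc k) (Suc j)"
    using side_block assms(4,5) by metis
  ultimately show False using crossing_iff[of k "Suc k"] assms(3) by simp
qed

lemma consecutive_crossings_within:
  assumes "i < j" "crossing i" "crossing j" "block (Suc i) = block (Suc j)"
  obtains i' j' where "i' < j'" "crossing i'" "crossing j'" "block (Suc i') = block (Suc j')"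
    "\<And>k. i' < k \<Longrightarrow> k < j' \<Longrightarrow> \<not> crossing k"
  using assms
proof (induction "j - i" arbitrary: i j thesis rule: less_induct)
  case less
  show ?case
  proof (cases "\<exists>k. i < k \<and> k < j \<and> crossing k")
    case True
    then obtain k where k: "i < k" "k < j" "crossing k" by blast
    obtain a b where ab: "a < b" "b - a < j - i" "crossing a" "crossing b" "block (Suc a) = block (Suc b)"
    proof (cases "block (Suc k) = block (Suc i)")
      case True
      then show thesis using that[of i k] k less.prems by simp
    next
      case False
      then obtain t where t: "i < t" "t < j" "t \<noteq> k" "crossing t" "block (Suc t) = block (Suc k)"
        using other_crossing_of_block[OF k less.prems(5)] by metis
      then show thesis using that[of t k] that[of k t] k by (cases t k rule: linorder_cases) auto
    qed
    show ?thesis by (rule less.hyps[OF ab(2) less.prems(1) ab(1,3-5)])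
  qed (use less.prems in blast)
qed

lemma consecutive_crossings:
  assumes "crossing i"
  obtains i' j' where "i' < j'" "crossing i'" "crossing j'" "block (Suc i') = block (Suc j')"
    "\<And>k. i' < k \<Longrightarrow> k < j' \<Longrightarrow> \<not> crossing k"
  using consecutive_crossings_within[of i "i + m"] assms crossing_period block_period[of "Suc i"]
    period_pos by (metis add_Suc less_add_same_cancel1)

end

lemma periodic_obtains_in_window:
  fixes f :: "nat \<Rightarrow> 'b"
  assumes period: "\<And>i. f (i + m) = f i" and "0 < m"
  obtains j where "k \<le> j" "j < k + m" "f j = f i"
proof
  have multiple: "f (i + q * m) = f i" for i q
    by (induction q) (simp_all add: period add.assoc[symmetric] add.commute[of m])
  define t where "t = i + k * m - k"
  have "k \<le> i + k * m" using \<open>0 < m\<close> by (simp add: trans_le_add2)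
  then have "k + t = i + k * m" by (simp add: t_def)
  then show "f (k + t mod m) = f i"
    using multiple[of "k + t mod m" "t div m"] multiple[of i k] by (simp add: add.assoc)
qed (use \<open>0 < m\<close> in simp_all)

lemma first_index_unique:
  fixes i j d :: nat
  assumes "i < j" "P j" "\<And>k. i < k \<Longrightarrow> k < j \<Longrightarrow> \<not> P k"
    and "0 < d" "P (i + d)" "\<And>e. 0 < e \<Longrightarrow> e < d \<Longrightarrow> \<not> P (i + e)"
  shows "j = i + d"
proof (cases j "i + d" rule: linorder_cases)
  case less
  then have "j - i < d" using assms(1) by linarith
  then show ?thesis using assms(1,2) assms(6)[of "j - i"] by simp
next
  case greater
  then show ?thesis using assms(3-5) by simp
qed

lemma consecutive_mod_6_cases:
  fixes i j :: nat
  assumes "i < j" and A: "A = {1, 3} \<or> A = {0, 1, 3, 4}" and "i mod 6 \<in> A" "j mod 6 \<in> A"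
    and none: "\<And>k. i < k \<Longrightarrow> k < j \<Longrightarrow> k mod 6 \<notin> A"
  shows "i mod 6 \<in> {0, 3} \<and> j = i + 1 \<or> i mod 6 \<in> {1, 4} \<and> j = i + 2 \<or> i mod 6 = 3 \<and> j = i + 4"
proof -
  have following: "j = i + d"
    if "0 < d" "(i mod 6 + d) mod 6 \<in> A" "\<And>e. 0 < e \<Longrightarrow> e < d \<Longrightarrow> (i mod 6 + e) mod 6 \<notin> A" for d
    using first_index_unique[where P = "\<lambda>k. k mod 6 \<in> A", OF assms(1,4) none] that
    by (simp add: mod_add_left_eq)
  from A show ?thesis
  proof
    assume A: "A = {1, 3}"
    then consider "i mod 6 = 1" | "i mod 6 = 3" using assms(3) by auto
    then show ?thesis
    proof cases
      case 1
      then show ?thesis using following[of 2] A by (auto simp: less_2_cases_iff)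
    next
      case 2
      then have "(i mod 6 + e) mod 6 \<notin> A" if "0 < e" "e < 4" for e
      proof -
        consider "e = 1" | "e = 2" | "e = 3" using \<open>0 < e\<close> \<open>e < 4\<close> by linarith
        then show ?thesis using 2 A by cases simp_all
      qed
      then show ?thesis using following[of 4] 2 A by simp
    qed
  next
    assume A: "A = {0, 1, 3, 4}"
    then consider "i mod 6 = 0" | "i mod 6 = 1" | "i mod 6 = 3" | "i mod 6 = 4" using assms(3) by auto
    then show ?thesis using following[of 1] following[of 2] A by cases (auto simp: less_2_cases_iff)
  qed
qed

section \<open>Walks and balls\<close>

lemma is_walk_iff_successively: "is_walk E xs \<longleftrightarrow> xs \<noteq> [] \<and> successively E xs"
  by (simp add: is_walk_def successively_conv_nth)

lemma relpowp_imp_walk: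
  "(E ^^ k) x y \<Longrightarrow> \<exists>xs. is_walk E xs \<and> hd xs = x \<and> last xs = y \<and> length xs = Suc k"
proof (induction k arbitrary: y)
  case 0
  then show ?case by (intro exI[of _ "[x]"]) (simp add: is_walk_iff_successively)
next
  case (Suc k)
  then obtain z where z: "(E ^^ k) x z" "E z y" by (auto elim: relpowp_Suc_E)
  obtain xs where "is_walk E xs" "hd xs = x" "last xs = z" "length xs = Suc k"
    using Suc.IH[OF z(1)] by blast
  with z(2) show ?case
    by (intro exI[of _ "xs @ [y]"]) (auto simp: is_walk_iff_successively successively_append_iff)
qed

lemma ball_edgeI:
  assumes "(E ^^ a) v z" "E z z'" "(E ^^ b) z' v" "a + b < r"
  shows "{z, z'} \<in> ball_edges E r v"
proof -
  obtain xs where xs: "is_walk E xs" "hd xs = v" "last xs = z" "length xs = Suc a"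
    using relpowp_imp_walk[OF assms(1)] by blast
  obtain ys where ys: "is_walk E ys" "hd ys = z'" "last ys = v" "length ys = Suc b"
    using relpowp_imp_walk[OF assms(3)] by blast
  have ne: "xs \<noteq> []" "ys \<noteq> []" using xs ys by (auto simp: is_walk_def)
  have "is_walk E (xs @ ys)"
    using xs ys assms(2) by (simp add: is_walk_iff_successively successively_append_iff)
  moreover have "hd (xs @ ys) = v" "last (xs @ ys) = v" "v \<in> set (xs @ ys)"
    using xs ys ne hd_in_set by fastforce+
  ultimately have "closed_walk_through E r v (xs @ ys)"
    using xs ys assms(4) by (simp add: closed_walk_through_def)
  moreover have "(xs @ ys) ! a = z" "(xs @ ys) ! Suc a = z'"
    using xs ys ne by (auto simp: nth_append last_conv_nth hd_conv_nth)
  moreover have "Suc a < length (xs @ ys)" using xs ys by simp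
  ultimately show ?thesis unfolding ball_edges_def by blast
qed

lemma ball_edge_subset_verts: "e \<in> ball_edges E r v \<Longrightarrow> e \<subseteq> ball_verts E r v"
  by (auto simp: ball_edges_def ball_verts_def intro: nth_mem)

lemma same_comp_refl: "a \<in> ball_verts E r v - Z \<Longrightarrow> same_comp E r v Z a a"
  by (simp add: same_comp_def)

lemma same_comp_sym: "same_comp E r v Z a b \<Longrightarrow> same_comp E r v Z b a"
proof -
  have "symp (ball_minus_adj E r v Z)"
    by (auto simp: symp_def ball_minus_adj_def insert_commute)
  then show "same_comp E r v Z a b \<Longrightarrow> same_comp E r v Z b a"
    by (auto simp: same_comp_def dest: symp_rtranclp sympD)
qed

lemma same_comp_step:
  assumes "same_comp E r v Z a z" "{z, z'} \<in> ball_edges E r v" "z' \<notin> Z"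
  shows "same_comp E r v Z a z'"
proof -
  have "z' \<in> ball_verts E r v" using ball_edge_subset_verts[OF assms(2)] by simp
  moreover have "ball_minus_adj E r v Z z z'"
    using assms by (auto simp: ball_minus_adj_def same_comp_def)
  ultimately show ?thesis using assms by (auto simp: same_comp_def intro: rtranclp.rtrancl_into_rtrancl)
qed

lemma conn_adj_rtranclp_sym:
  "(conn_adj E r v0 v1)\<^sup>*\<^sup>* a b \<Longrightarrow> (conn_adj E r v0 v1)\<^sup>*\<^sup>* b a"
proof -
  have "symp (conn_adj E r v0 v1)"
    by (auto simp: symp_def conn_adj_def dest: same_comp_sym)
  then show "(conn_adj E r v0 v1)\<^sup>*\<^sup>* a b \<Longrightarrow> (conn_adj E r v0 v1)\<^sup>*\<^sup>* b a"
    by (auto dest: symp_rtranclp sympD)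
qed

section \<open>Words in groups\<close>

lemma map_nth_mod_upt:
  "map (\<lambda>i. f (xs ! (i mod length xs))) [0..<N * length xs] = concat (replicate N (map f xs))"
proof (induction N)
  case (Suc N)
  let ?L = "length xs" and ?f = "\<lambda>i. f (xs ! (i mod length xs))"
  have "[0..<Suc N * ?L] = [0..<?L] @ map (\<lambda>i. i + ?L) [0..<N * ?L]"
    using upt_add_eq_append[of 0 ?L "N * ?L"] by (simp add: map_add_upt add.commute)
  moreover have "map ?f [0..<?L] = map f xs" by (auto intro: nth_equalityI)
  ultimately show ?case using Suc by (simp add: comp_def)
qed simp

context group
begin

definition word_prod :: "'a list \<Rightarrow> 'a" where
  "word_prod xs = foldr (\<otimes>) xs \<one>"

lemma word_prod_simps [simp]: "word_prod [] = \<one>" "word_prod (x # xs) = x \<otimes> word_prod xs"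
  by (simp_all add: word_prod_def)

lemma word_prod_closed [simp]: "set xs \<subseteq> carrier G \<Longrightarrow> word_prod xs \<in> carrier G"
  unfolding word_prod_def by (rule multlist_closed)

lemma word_prod_append:
  "set xs \<subseteq> carrier G \<Longrightarrow> set ys \<subseteq> carrier G \<Longrightarrow> word_prod (xs @ ys) = word_prod xs \<otimes> word_prod ys"
  by (induction xs) (auto simp: m_assoc)

lemma word_prod_concat_replicate:
  assumes "set xs \<subseteq> carrier G"
  shows "word_prod (concat (replicate N xs)) = word_prod xs [^] N"
proof (induction N)
  case (Suc N)
  have "set (concat (replicate N xs)) \<subseteq> carrier G" using assms by (auto split: if_splits)
  then show ?case using Suc assms by (simp add: word_prod_append flip: nat_pow_Suc2)
qed simp

lemma l_coset_eq_iff: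
  assumes "subgroup H G" "x \<in> carrier G" "y \<in> carrier G"
  shows "x <# H = y <# H \<longleftrightarrow> inv x \<otimes> y \<in> H"
proof -
  interpret subgroup H G by fact
  show ?thesis
    using eq_equiv_class_iff[OF equiv_rcong assms(2,3)] assms(2,3)
    by (simp add: l_coset_eq_rcong is_group) (simp add: r_congruent_def)
qed

lemma inv_cancel_left [simp]:
  "x \<in> carrier G \<Longrightarrow> y \<in> carrier G \<Longrightarrow> inv x \<otimes> (x \<otimes> y) = y"
  "x \<in> carrier G \<Longrightarrow> y \<in> carrier G \<Longrightarrow> x \<otimes> (inv x \<otimes> y) = y"
  by (simp_all add: m_assoc[symmetric])

lemma inv_commute_iff:
  assumes "x \<in> carrier G" "y \<in> carrier G"
  shows "inv x \<otimes> y = y \<otimes> inv x \<longleftrightarrow> x \<otimes> y = y \<otimes> x"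
proof
  assume "inv x \<otimes> y = y \<otimes> inv x"
  then have "x \<otimes> (inv x \<otimes> y) \<otimes> x = x \<otimes> (y \<otimes> inv x) \<otimes> x" by simp
  then show "x \<otimes> y = y \<otimes> x" using assms by (simp add: m_assoc)
next
  assume "x \<otimes> y = y \<otimes> x"
  then have "inv x \<otimes> (y \<otimes> x) \<otimes> inv x = inv x \<otimes> (x \<otimes> y) \<otimes> inv x" by simp
  then show "inv x \<otimes> y = y \<otimes> inv x" using assms by (simp add: m_assoc)
qed

lemma generate_commute:
  assumes "A \<subseteq> carrier G" "y \<in> carrier G" "\<And>a. a \<in> A \<Longrightarrow> a \<otimes> y = y \<otimes> a" "x \<in> generate G A"
  shows "x \<otimes> y = y \<otimes> x"
  using assms(4)
proof induction
  case (inv a)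
  then show ?case using assms inv_commute_iff by blast
next
  case (eng x1 x2)
  then have "x1 \<in> carrier G" "x2 \<in> carrier G" using generate_in_carrier[OF assms(1)] by auto
  then show ?case using eng assms(2) by (metis m_assoc)
qed (use assms in auto)

lemma subgroup_mult_mem_iff:
  assumes "subgroup H G" "x \<in> carrier G" "t \<in> H"
  shows "x \<otimes> t \<in> H \<longleftrightarrow> x \<in> H"
proof -
  interpret subgroup H G by fact
  have "x = x \<otimes> t \<otimes> inv t" using assms by (simp add: m_assoc)
  then show ?thesis using assms(3) by (metis m_closed m_inv_closed)
qed

lemma conj_mem_imp_mem:
  assumes "x \<in> carrier G" "y \<in> carrier G" "A \<subseteq> carrier G"
    and commute: "\<And>a. a \<in> A \<Longrightarrow> x \<otimes> a = a \<otimes> x" and conj: "x \<otimes> y \<otimes> inv x \<in> A"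
  shows "y \<in> A"
proof -
  have "x \<otimes> y = (x \<otimes> y \<otimes> inv x) \<otimes> x" using assms(1,2) by (simp add: m_assoc)
  also have "\<dots> = x \<otimes> (x \<otimes> y \<otimes> inv x)" using commute[OF conj] by simp
  finally have "y = x \<otimes> y \<otimes> inv x" by (rule l_cancel) (use assms(1,2) in simp_all)
  then show ?thesis using conj by simp
qed

end

section \<open>Commutators with an involution\<close>

context group
begin

lemma involution_inv: "h \<in> carrier G \<Longrightarrow> h \<otimes> h = \<one> \<Longrightarrow> inv h = h"
  by (simp add: inv_equality)

lemma involution_cancel:
  "h \<in> carrier G \<Longrightarrow> h \<otimes> h = \<one> \<Longrightarrow> x \<in> carrier G \<Longrightarrow> h \<otimes> (h \<otimes> x) = x"
  by (simp add: m_assoc[symmetric])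

text \<open>Conjugation by \<open>h\<close> inverts \<open>[h, y]\<^sub>1\<close> and its powers, so each further commutator with \<open>h\<close> is
  a squaring.\<close>

lemma itcomm_involution:
  assumes h: "h \<in> carrier G" "h \<otimes> h = \<one>" and y: "y \<in> carrier G"
  shows "itcomm G h y (Suc k) = (h \<otimes> inv y \<otimes> h \<otimes> y) [^] ((2::nat) ^ k) \<and>
    h \<otimes> inv (itcomm G h y (Suc k)) \<otimes> h = itcomm G h y (Suc k)"
proof (induction k)
  case 0
  show ?case using h y by (simp add: m_assoc inv_mult_group involution_inv involution_cancel)
next
  case (Suc k)
  define x where "x = itcomm G h y (Suc k)"
  have x: "x \<in> carrier G" using Suc h y by (simp add: x_def del: itcomm.simps)
  have inverted: "h \<otimes> inv x \<otimes> h = x" using Suc unfolding x_def by blast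
  have square: "itcomm G h y (Suc (Suc k)) = x \<otimes> x"
    unfolding itcomm.simps(2)[of G h y "Suc k"] x_def[symmetric] involution_inv[OF h] inverted ..
  have "h \<otimes> inv (x \<otimes> x) \<otimes> h = (h \<otimes> inv x \<otimes> h) \<otimes> (h \<otimes> inv x \<otimes> h)"
    using h x by (simp add: inv_mult_group m_assoc involution_cancel)
  then have "h \<otimes> inv (x \<otimes> x) \<otimes> h = x \<otimes> x" by (simp only: inverted)
  moreover have "x \<otimes> x = (h \<otimes> inv y \<otimes> h \<otimes> y) [^] ((2::nat) ^ Suc k)"
    using Suc h y by (simp add: x_def nat_pow_mult mult_2 del: itcomm.simps)
  ultimately show ?case using square by simp
qed

lemma nilpotent_involution_commutator_power:
  assumes "nilpotent_le G n" "1 \<le> n" and h: "h \<in> carrier G" "h \<otimes> h = \<one>" and y: "y \<in> carrier G"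
  shows "(inv y \<otimes> h \<otimes> y \<otimes> h) [^] ((2::nat) ^ (n - 1)) = \<one>"
proof (cases "y = h")
  case False
  have "(h \<otimes> inv y \<otimes> h \<otimes> y) [^] ((2::nat) ^ (n - 1)) = itcomm G h y n"
    using itcomm_involution[OF h y, of "n - 1"] assms(2) by simp
  also have "\<dots> = \<one>"
    using assms(1) h y False involution_inv[OF h] by (metis inv_inv nilpotent_le_def)
  finally have "inv (h \<otimes> inv y \<otimes> h \<otimes> y) [^] ((2::nat) ^ (n - 1)) = \<one>"
    using h y by (simp add: nat_pow_inv)
  then show ?thesis using h y by (simp add: inv_mult_group m_assoc involution_inv)
qed (use h in \<open>simp add: involution_inv\<close>)

end

section \<open>Cosets of an involution in a Cayley graph\<close>

locale cayley_graph = group G for G (structure) +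
  fixes S :: "'a set"
  assumes S_sub: "S \<subseteq> carrier G - {\<one>}"
    and S_inv: "s \<in> S \<Longrightarrow> inv s \<in> S"
begin

abbreviation "E \<equiv> cay_adj G S"

lemma S_carrier [simp]: "s \<in> S \<Longrightarrow> s \<in> carrier G"
  using S_sub by blast

lemma adjI: "x \<in> carrier G \<Longrightarrow> s \<in> S \<Longrightarrow> E x (x \<otimes> s)"
  by (auto simp: cay_adj_def)

lemma adj_sym: "E x y \<Longrightarrow> E y x"
  using S_inv by (force simp: cay_adj_def m_assoc intro!: bexI[of _ "inv _"])

lemma adj_translate: "v \<in> carrier G \<Longrightarrow> E x y \<Longrightarrow> E (v \<otimes> x) (v \<otimes> y)"
  by (auto simp: cay_adj_def m_assoc)

lemma relpowp_adj_translate: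
  "v \<in> carrier G \<Longrightarrow> (E ^^ k) x y \<Longrightarrow> (E ^^ k) (v \<otimes> x) (v \<otimes> y)"
  by (induction k arbitrary: y) (auto dest: adj_translate)

lemma ball_edge_translated:
  assumes "v \<in> carrier G" "(E ^^ a) v z" "E z z'" "(E ^^ b) z' v" "a + b < r"
  shows "{inv v \<otimes> z, inv v \<otimes> z'} \<in> ball_edges E r \<one>"
  using ball_edgeI[of a E "inv v \<otimes> v" "inv v \<otimes> z" "inv v \<otimes> z'" b r] assms
    relpowp_adj_translate[of "inv v"] adj_translate[of "inv v"] by (metis inv_closed l_inv)

end

locale cayley_involution = cayley_graph +
  fixes h :: 'a and r :: nat
  assumes h_S: "h \<in> S" and h_sq [simp]: "h \<otimes> h = \<one>"
begin

abbreviation "H \<equiv> {\<one>, h}"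

lemma h_carrier [simp]: "h \<in> carrier G"
  using h_S by simp

lemma h_inv [simp]: "inv h = h"
  by (rule involution_inv) simp_all

lemma h_cancel [simp]: "x \<in> carrier G \<Longrightarrow> h \<otimes> (h \<otimes> x) = x"
  by (rule involution_cancel) simp_all

lemma h_ne_one: "h \<noteq> \<one>"
  using h_S S_sub by blast

lemma H_subgroup: "subgroup H G"
  by (rule subgroupI) auto

lemma conj_h_in_H_iff:
  assumes x: "x \<in> carrier G"
  shows "x \<otimes> h \<otimes> inv x \<in> H \<longleftrightarrow> x \<otimes> h = h \<otimes> x"
proof
  assume conj: "x \<otimes> h \<otimes> inv x \<in> H"
  have "x \<otimes> h = (x \<otimes> h \<otimes> inv x) \<otimes> x" using x by (simp add: m_assoc)
  then show "x \<otimes> h = h \<otimes> x" using conj x h_ne_one by auto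
qed (use x in \<open>simp add: m_assoc\<close>)

lemma inv_in_generators: "s \<in> S - {h} \<Longrightarrow> inv s \<in> S - {h}"
  using S_inv by (metis Diff_iff S_carrier h_inv inv_inv singletonD singletonI)

lemma generator_notin_H: "s \<in> S - {h} \<Longrightarrow> s \<notin> H"
  using S_sub by blast

lemma nbhd_iff: "a \<in> nbhd E H \<longleftrightarrow> (\<exists>t\<in>H. \<exists>s\<in>S - {h}. a = t \<otimes> s)"
proof
  assume "a \<in> nbhd E H"
  then obtain t where t: "t \<in> H" "E t a" "a \<notin> H" by (auto simp: nbhd_def)
  then obtain s where "s \<in> S" "a = t \<otimes> s" by (auto simp: cay_adj_def)
  with t show "\<exists>t\<in>H. \<exists>s\<in>S - {h}. a = t \<otimes> s" by (intro bexI[of _ t] bexI[of _ s]) auto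
next
  assume "\<exists>t\<in>H. \<exists>s\<in>S - {h}. a = t \<otimes> s"
  then obtain t s where t: "t \<in> H" and s: "s \<in> S - {h}" and a: "a = t \<otimes> s" by blast
  interpret H: subgroup H G by (rule H_subgroup)
  have "s = inv t \<otimes> a" using t s a by auto
  then have "a \<notin> H"
    using generator_notin_H[OF s] H.m_closed[OF H.m_inv_closed[OF t]] by blast
  moreover have "E t a" using adjI[of t s] t s a by auto
  ultimately show "a \<in> nbhd E H" using t by (auto simp: nbhd_def)
qed

lemma generator_in_nbhd: "s \<in> S - {h} \<Longrightarrow> s \<in> nbhd E H"
  using nbhd_iff by fastforce

definition comp_closed :: "'a set \<Rightarrow> bool" where
  "comp_closed K \<longleftrightarrow> K \<subseteq> nbhd E H \<and> (\<forall>a\<in>K. \<forall>b. conn_adj E r \<one> h a b \<longrightarrow> b \<in> K)"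

text \<open>\<open>z\<close> lies on the \<open>K\<close>-side of the local separator \<open>v <# H\<close>, as seen from its
  vertex \<open>v\<close>.\<close>

definition on_side :: "'a set \<Rightarrow> 'a \<Rightarrow> 'a \<Rightarrow> bool" where
  "on_side K v z \<longleftrightarrow> (\<exists>a\<in>K. same_comp E r \<one> H a (inv v \<otimes> z))"

lemma on_side_ball_edge:
  assumes edge: "{inv v \<otimes> z, inv v \<otimes> z'} \<in> ball_edges E r \<one>"
    and "inv v \<otimes> z \<notin> H" "inv v \<otimes> z' \<notin> H"
  shows "on_side K v z \<longleftrightarrow> on_side K v z'"
  using same_comp_step[OF _ edge] same_comp_step[OF _ edge[unfolded insert_commute[of "inv v \<otimes> z"]]]
    assms(2,3) unfolding on_side_def by blast

lemma on_side_nbhd: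
  assumes "comp_closed K" "inv v \<otimes> z \<in> ball_verts E r \<one>" "inv v \<otimes> z \<in> nbhd E H"
  shows "on_side K v z \<longleftrightarrow> inv v \<otimes> z \<in> K"
proof
  assume "on_side K v z"
  then show "inv v \<otimes> z \<in> K"
    using assms(1,3) unfolding on_side_def comp_closed_def conn_adj_def by blast
next
  assume "inv v \<otimes> z \<in> K"
  moreover have "same_comp E r \<one> H (inv v \<otimes> z) (inv v \<otimes> z)"
    using assms(2,3) by (intro same_comp_refl) (auto simp: nbhd_def)
  ultimately show "on_side K v z" unfolding on_side_def by blast
qed

definition component :: "'a \<Rightarrow> 'a set" where
  "component a = {b. (conn_adj E r \<one> h)\<^sup>*\<^sup>* a b}"

lemma component_closed: "a \<in> nbhd E H \<Longrightarrow> comp_closed (component a)"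
proof -
  assume a: "a \<in> nbhd E H"
  have "b \<in> nbhd E H" if "(conn_adj E r \<one> h)\<^sup>*\<^sup>* a b" for b
    using that a by induction (auto simp: conn_adj_def)
  then show ?thesis
    by (auto simp: comp_closed_def component_def intro: rtranclp.rtrancl_into_rtrancl)
qed

lemma component_self [simp]: "a \<in> component a"
  by (simp add: component_def)

lemma component_sym: "b \<in> component a \<Longrightarrow> a \<in> component b"
  by (auto simp: component_def dest: conn_adj_rtranclp_sym)

lemma component_trans: "b \<in> component a \<Longrightarrow> c \<in> component b \<Longrightarrow> c \<in> component a"
  by (auto simp: component_def)

end

section \<open>Closed walks through cosets\<close>

text \<open>A spacer \<open>c i = h\<close> takes the edge inside a coset, so that consecutive positions always lie in
  different cosets.\<close>

locale coset_walk = cayley_involution +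
  fixes s c :: "nat \<Rightarrow> 'a" and m :: nat
  assumes letter: "s i \<in> S - {h}" and spacer: "c i \<in> H"
    and s_period: "s (i + m) = s i" and c_period: "c (i + m) = c i" and m_pos: "0 < m"
    and closed: "word_prod (map (\<lambda>i. s i \<otimes> c i) [0..<m]) = \<one>"
    and short: "(\<Sum>i<m. if c i = \<one> then 1 else 2) \<le> r"
begin

definition position :: "nat \<Rightarrow> 'a" where
  "position i = word_prod (map (\<lambda>i. s i \<otimes> c i) [0..<i])"

definition walk_length :: "nat \<Rightarrow> nat" where
  "walk_length i = (\<Sum>j<i. if c j = \<one> then 1 else 2)"

lemma letter_carrier [simp]: "s i \<in> carrier G"
  using letter by simp

lemma spacer_carrier [simp]: "c i \<in> carrier G"
  using spacer[of i] by (elim insertE) simp_all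

lemma spacer_cancel [simp]: "c i \<otimes> c i = \<one>" "x \<in> carrier G \<Longrightarrow> c i \<otimes> (c i \<otimes> x) = x"
  using spacer[of i] by (elim insertE; simp)+

lemma position_closed [simp]: "position i \<in> carrier G"
  unfolding position_def by (rule word_prod_closed) auto

lemma position_add: "position (i + d) = position i \<otimes> word_prod (map (\<lambda>i. s i \<otimes> c i) [i..<i + d])"
  unfolding position_def by (subst upt_add_eq_append) (auto intro!: word_prod_append)

lemma position_Suc: "position (Suc i) = position i \<otimes> s i \<otimes> c i"
  using position_add[of i 1] by (simp add: m_assoc)

lemma position_period: "position (i + m) = position i"
proof (induction i)
  case 0
  then show ?case using closed by (simp add: position_def)
qed (simp add: position_Suc s_period c_period)

lemma walk_length_period: "walk_length (i + m) = walk_length i + walk_length m"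
  by (induction i) (simp_all add: walk_length_def c_period)

lemma walk_length_mono: "i \<le> j \<Longrightarrow> walk_length i \<le> walk_length j"
  unfolding walk_length_def by (rule sum_mono2) auto

lemma walk_length_strict: "i < j \<Longrightarrow> walk_length i < walk_length j"
  using walk_length_mono[of "Suc i" j] by (simp add: walk_length_def split: if_splits)

lemma adj_h: "x \<in> carrier G \<Longrightarrow> E x (x \<otimes> h)"
  using adjI h_S by blast

lemma adj_letter: "E (position i) (position i \<otimes> s i)"
  using adjI letter by simp

lemma adj_spacer: "c i = h \<Longrightarrow> E (position i \<otimes> s i) (position (Suc i))"
  using adj_h by (simp add: position_Suc)

lemma walk_Suc:
  "(E ^^ (walk_length (Suc i) - walk_length i)) (position i) (position (Suc i))"
proof (cases "c i = \<one>")
  case True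
  then show ?thesis using adj_letter[of i] by (simp add: walk_length_def position_Suc eq_OO)
next
  case False
  then have "c i = h" using spacer by blast
  then have "(E ^^ Suc (Suc 0)) (position i) (position (Suc i))"
    using relpowp_Suc_I[OF relpowp_Suc_I] adj_letter adj_spacer by (metis relpowp_0_I)
  then show ?thesis using False by (simp add: walk_length_def numeral_2_eq_2)
qed

lemma walk_between: "i \<le> j \<Longrightarrow> (E ^^ (walk_length j - walk_length i)) (position i) (position j)"
proof (induction j rule: dec_induct)
  case (step j)
  then have "(E ^^ ((walk_length j - walk_length i) + (walk_length (Suc j) - walk_length j)))
      (position i) (position (Suc j))"
    using walk_Suc by (auto simp: relpowp_add)
  then show ?case using walk_length_mono[of i j] walk_length_mono[of j "Suc j"] step by simp
qed simp

text \<open>Replacing a part of the closed walk by one that is no longer leaves a closed walk of length at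
  most \<open>r\<close>.\<close>

lemma shortcut_in_ball:
  assumes "k \<le> i" "i \<le> j" "j \<le> k + m"
    and a: "(E ^^ a) (position i) z" and z: "E z z'" and b: "(E ^^ b) z' (position j)"
    and "a + b < walk_length j - walk_length i"
  shows "{inv position k \<otimes> z, inv position k \<otimes> z'} \<in> ball_edges E r \<one>"
proof (rule ball_edge_translated[OF position_closed _ z])
  show "(E ^^ (walk_length i - walk_length k + a)) (position k) z"
    using walk_between[OF assms(1)] a by (auto simp: relpowp_add)
  show "(E ^^ (b + (walk_length (k + m) - walk_length j))) z' (position k)"
    using walk_between[OF assms(3)] b by (auto simp: relpowp_add position_period)
  show "walk_length i - walk_length k + a + (b + (walk_length (k + m) - walk_length j)) < r"
    using assms(7) short walk_length_mono[OF assms(1)] walk_length_mono[OF assms(3)]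
    by (simp add: walk_length_period) (simp add: walk_length_def)
qed

lemma position_in_window:
  obtains j where "k \<le> j" "j < k + m" "position j = position i" "s j = s i" "c j = c i"
  using periodic_obtains_in_window[of "\<lambda>i. (position i, s i, c i)" m k i]
    position_period s_period c_period m_pos by (metis prod.inject)

lemma letter_edge_in_ball:
  "{inv position k \<otimes> position i, inv position k \<otimes> (position i \<otimes> s i)} \<in> ball_edges E r \<one>"
proof -
  obtain j where j: "k \<le> j" "j < k + m" "position j = position i" "s j = s i" "c j = c i"
    by (rule position_in_window)
  have "(E ^^ (walk_length (Suc j) - walk_length j - 1)) (position j \<otimes> s j) (position (Suc j))"
    using adj_spacer[of j] spacer[of j] by (auto simp: walk_length_def position_Suc eq_OO)
  then show ?thesis
    using shortcut_in_ball[of k j "Suc j" 0 "position j" "position j \<otimes> s j"] j adj_letter[of j]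
      walk_length_strict[of j "Suc j"] by simp
qed

lemma spacer_edge_in_ball:
  assumes "c i = h"
  shows "{inv position k \<otimes> (position i \<otimes> s i), inv position k \<otimes> position (Suc i)} \<in> ball_edges E r \<one>"
proof -
  obtain j where j: "k \<le> j" "j < k + m" "position j = position i" "s j = s i" "c j = c i"
    by (rule position_in_window)
  then show ?thesis
    using shortcut_in_ball[of k j "Suc j" 1 "position j \<otimes> s j" "position (Suc j)" 0] assms
      adj_letter[of j] adj_spacer[of j] h_ne_one
    by (simp add: eq_OO position_Suc) (simp add: walk_length_def)
qed

lemma coset_edge_in_ball:
  assumes "position j = position i \<otimes> h"
  shows "{inv position k \<otimes> position i, inv position k \<otimes> position j} \<in> ball_edges E r \<one>"
proof -
  obtain i' where i': "k \<le> i'" "i' < k + m" "position i' = position i"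
    using position_in_window by metis
  obtain j' where j': "k \<le> j'" "j' < k + m" "position j' = position j"
    using position_in_window by metis
  have ij: "E (position i) (position j)" using adj_h assms by simp
  have "position j \<noteq> position i" using assms h_ne_one by (simp add: r_cancel_one')
  then have "i' \<noteq> j'" using i' j' by metis
  then consider "i' < j'" | "j' < i'" by linarith
  then show ?thesis
  proof cases
    case 1
    then show ?thesis
      using shortcut_in_ball[of k i' j' 0 "position i'" "position j'" 0] i' j' ij
        walk_length_strict[of i' j'] by simp
  next
    case 2
    then show ?thesis
      using shortcut_in_ball[of k j' i' 0 "position j'" "position i'" 0] i' j' adj_sym[OF ij]
        walk_length_strict[of j' i'] by (simp add: insert_commute)
  qed
qed

abbreviation "block i \<equiv> position i <# H"

lemma block_eq_iff: "block i = block k \<longleftrightarrow> inv position k \<otimes> position i \<in> H"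
  using l_coset_eq_iff[OF H_subgroup, of "position k" "position i"] by auto

lemma block_Suc: "block (Suc i) \<noteq> block i"
proof
  assume "block (Suc i) = block i"
  then have "s i \<otimes> c i \<in> H" by (simp only: block_eq_iff) (simp add: position_Suc m_assoc)
  then show False
    using generator_notin_H[OF letter] subgroup_mult_mem_iff[OF H_subgroup letter_carrier spacer] by blast
qed

end

context cayley_involution
begin

lemma coset_walk_repeat:
  fixes ws cs :: "'a list"
  assumes s: "\<And>i. s i = ws ! (i mod length ws)" and c: "\<And>i. c i = cs ! (i mod length ws)"
    and ws: "ws \<noteq> []" "set ws \<subseteq> S - {h}" and cs: "length cs = length ws" "set cs \<subseteq> H"
    and "0 < N" and prod: "word_prod (map2 (\<otimes>) ws cs) [^] N = \<one>"
    and len: "N * (\<Sum>y\<leftarrow>cs. if y = \<one> then 1 else 2) \<le> r"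
  shows "coset_walk G S h r s c (N * length ws)"
proof
  have "i mod length ws < length ws" for i using ws(1) by simp
  then show "s i \<in> S - {h}" "c i \<in> H" for i
    using nth_mem ws(2) cs unfolding s c by (metis subsetD)+
  show "s (i + N * length ws) = s i" "c (i + N * length ws) = c i" for i
    by (simp_all add: s c)
  have "map (\<lambda>i. s i \<otimes> c i) [0..<N * length ws] = concat (replicate N (map2 (\<otimes>) ws cs))"
    using map_nth_mod_upt[of "\<lambda>(x, y). x \<otimes> y" "zip ws cs" N] ws(1) cs(1) by (simp add: s c)
  moreover have "set (map2 (\<otimes>) ws cs) \<subseteq> carrier G"
    using ws(2) cs(2) by (fastforce dest: set_zip_leftD set_zip_rightD)
  ultimately show "word_prod (map (\<lambda>i. s i \<otimes> c i) [0..<N * length ws]) = \<one>"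
    by (simp only: word_prod_concat_replicate prod)
  have "(\<Sum>i<N * length ws. if c i = \<one> then 1 else 2 :: nat) =
      sum_list (concat (replicate N (map (\<lambda>y. if y = \<one> then 1 else 2) cs)))"
    unfolding map_nth_mod_upt[symmetric] interv_sum_list_conv_sum_set_nat
    by (simp add: c cs(1) lessThan_atLeast0)
  also have "\<dots> = N * (\<Sum>y\<leftarrow>cs. if y = \<one> then 1 else 2)" by (induction N) simp_all
  finally show "(\<Sum>i<N * length ws. if c i = \<one> then 1 else 2) \<le> r" using len by simp
qed (use ws(1) \<open>0 < N\<close> in simp)

end

text \<open>The last assumption says that the two vertices of a coset agree on whether it is crossed.\<close>

locale sided_coset_walk = coset_walk +
  fixes K :: "'a set"
  assumes K_closed: "comp_closed K"
    and crossing_unambiguous: "(c i \<otimes> inv s i \<in> K) = (s (Suc i) \<in> K) \<longleftrightarrow>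
      (h \<otimes> (c i \<otimes> inv s i) \<in> K) = (h \<otimes> s (Suc i) \<in> K)"
begin

definition crossing :: "nat \<Rightarrow> bool" where
  "crossing i \<longleftrightarrow> (c i \<otimes> inv s i \<in> K) \<noteq> (s (Suc i) \<in> K)"

abbreviation "side k i \<equiv> on_side K (position k) (position i)"

lemma arrival_in_next_block:
  assumes "block (Suc i) \<noteq> block k"
  shows "inv position k \<otimes> (position i \<otimes> s i) \<notin> H"
proof -
  have "inv position k \<otimes> (position i \<otimes> s i) \<otimes> c i = inv position k \<otimes> position (Suc i)"
    by (simp add: position_Suc m_assoc)
  moreover have "inv position k \<otimes> (position i \<otimes> s i) \<in> carrier G" by simp
  ultimately show ?thesis using assms block_eq_iff subgroup_mult_mem_iff[OF H_subgroup _ spacer] by metis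
qed

lemma side_letter:
  assumes "block i \<noteq> block k" "block (Suc i) \<noteq> block k"
  shows "side k i \<longleftrightarrow> on_side K (position k) (position i \<otimes> s i)"
  using assms arrival_in_next_block
  by (intro on_side_ball_edge letter_edge_in_ball) (auto simp: block_eq_iff)

lemma side_spacer:
  assumes "block (Suc i) \<noteq> block k"
  shows "on_side K (position k) (position i \<otimes> s i) \<longleftrightarrow> side k (Suc i)"
proof (cases "c i = \<one>")
  case False
  then have "c i = h" using spacer by blast
  then show ?thesis
    using assms arrival_in_next_block
    by (intro on_side_ball_edge spacer_edge_in_ball) (auto simp: block_eq_iff)
qed (simp add: position_Suc)

lemma side_block:
  assumes "block i = block j" "block i \<noteq> block k"
  shows "side k i = side k j"
proof (cases "position j = position i")
  case False
  obtain t where t: "t \<in> H" "inv position i \<otimes> position j = t"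
    using assms(1) block_eq_iff[of j i] by auto
  have "position j = position i \<otimes> t" unfolding t(2)[symmetric] by simp
  then have "position j = position i \<otimes> h" using t(1) False by auto
  moreover have "inv position k \<otimes> position i \<notin> H" "inv position k \<otimes> position j \<notin> H"
    using assms block_eq_iff by metis+
  ultimately show ?thesis by (intro on_side_ball_edge coset_edge_in_ball)
qed simp

lemma crossing_iff_sides_differ:
  assumes "block (Suc i) = block k"
  shows "crossing i \<longleftrightarrow> side k i \<noteq> side k (Suc (Suc i))"
proof -
  define t where "t = inv position k \<otimes> position (Suc i)"
  have t: "t \<in> H" using assms block_eq_iff by (simp add: t_def)
  have before: "inv position k \<otimes> position i = t \<otimes> (c i \<otimes> inv s i)"
    by (simp add: t_def position_Suc m_assoc)
  have after: "inv position k \<otimes> (position (Suc i) \<otimes> s (Suc i)) = t \<otimes> s (Suc i)"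
    by (simp add: t_def m_assoc)
  interpret H: subgroup H G by (rule H_subgroup)
  have "t \<otimes> c i \<in> H" using t spacer by (rule H.m_closed)
  moreover have "t \<otimes> (c i \<otimes> inv s i) = t \<otimes> c i \<otimes> inv s i" using t by (auto simp: m_assoc)
  ultimately have nbhd: "t \<otimes> (c i \<otimes> inv s i) \<in> nbhd E H" "t \<otimes> s (Suc i) \<in> nbhd E H"
    using t letter inv_in_generators unfolding nbhd_iff by blast+
  have "side k i \<longleftrightarrow> t \<otimes> (c i \<otimes> inv s i) \<in> K"
    using on_side_nbhd[OF K_closed, of "position k" "position i"] nbhd
      ball_edge_subset_verts[OF letter_edge_in_ball[of k i]] by (simp add: before)
  moreover have "side k (Suc (Suc i)) \<longleftrightarrow> t \<otimes> s (Suc i) \<in> K"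
  proof -
    have "on_side K (position k) (position (Suc i) \<otimes> s (Suc i)) \<longleftrightarrow> t \<otimes> s (Suc i) \<in> K"
      using on_side_nbhd[OF K_closed, of "position k" "position (Suc i) \<otimes> s (Suc i)"] nbhd
        ball_edge_subset_verts[OF letter_edge_in_ball[of k "Suc i"]] by (simp add: after)
    then show ?thesis using side_spacer block_Suc[of "Suc i"] assms by simp
  qed
  ultimately show ?thesis using t crossing_unambiguous[of i] by (auto simp: crossing_def)
qed

sublocale crossing_sequence block side crossing m
proof
  show "side k i = side k (Suc i)" if "block i \<noteq> block k" "block (Suc i) \<noteq> block k" for i k
    using side_letter[OF that] side_spacer[OF that(2)] by simp
  show "block (i + m) = block i" for i by (simp only: position_period)
  show "crossing (i + m) = crossing i" for i
    using s_period[of "Suc i"] by (simp add: crossing_def s_period c_period)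
qed (fact block_Suc side_block crossing_iff_sides_differ m_pos)+

lemma consecutive_crossings_segment:
  assumes "crossing i"
  obtains i' j' where "i' < j'" "crossing i'" "crossing j'" "\<And>k. i' < k \<Longrightarrow> k < j' \<Longrightarrow> \<not> crossing k"
    "word_prod (map (\<lambda>i. s i \<otimes> c i) [Suc i'..<Suc j']) \<in> H"
proof -
  obtain i' j' where ij: "i' < j'" "crossing i'" "crossing j'" "block (Suc i') = block (Suc j')"
    "\<And>k. i' < k \<Longrightarrow> k < j' \<Longrightarrow> \<not> crossing k"
    using assms consecutive_crossings by blast
  let ?w = "word_prod (map (\<lambda>i. s i \<otimes> c i) [Suc i'..<Suc j'])"
  have "?w \<in> carrier G" by (rule word_prod_closed) auto
  moreover have "position (Suc j') = position (Suc i') \<otimes> ?w"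
    using position_add[of "Suc i'" "j' - i'"] ij(1) by simp
  ultimately have "?w = inv position (Suc i') \<otimes> position (Suc j')" by simp
  then show thesis using that[OF ij(1-3,5)] ij(4) block_eq_iff by metis
qed

end

section \<open>Nilpotent groups\<close>

locale nilpotent_cayley = cayley_involution +
  fixes n :: nat
  assumes n_pos: "1 \<le> n" and nilp: "nilpotent_le G n" and r_large: "2 ^ (n + 2) \<le> r"
begin

lemma commutator_walk_segment:
  fixes ws cs :: "'a list"
  assumes s: "\<And>i. s i = ws ! (i mod length ws)" and c: "\<And>i. c i = cs ! (i mod length ws)"
    and ws: "ws \<noteq> []" "set ws \<subseteq> S - {h}" and cs: "length cs = length ws" "set cs \<subseteq> H"
    and y: "y \<in> carrier G" "word_prod (map2 (\<otimes>) ws cs) = inv y \<otimes> h \<otimes> y \<otimes> h"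
    and len: "(\<Sum>y\<leftarrow>cs. if y = \<one> then 1 else 2 :: nat) \<le> 8"
    and K: "comp_closed K"
    and crossing: "\<And>i. crossing i \<longleftrightarrow> (c i \<otimes> inv s i \<in> K) \<noteq> (s (Suc i) \<in> K)"
      "\<And>i. crossing i \<longleftrightarrow> (h \<otimes> (c i \<otimes> inv s i) \<in> K) \<noteq> (h \<otimes> s (Suc i) \<in> K)"
    and "crossing i0"
  obtains i j where "i < j" "crossing i" "crossing j" "\<And>k. i < k \<Longrightarrow> k < j \<Longrightarrow> \<not> crossing k"
    "word_prod (map (\<lambda>i. s i \<otimes> c i) [Suc i..<Suc j]) \<in> H"
proof -
  have "coset_walk G S h r s c (2 ^ (n - 1) * length ws)"
  proof (rule coset_walk_repeat[OF s c ws cs])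
    have "(2::nat) ^ (n + 2) = 2 ^ (n - 1) * 8"
      using n_pos power_add[of "2::nat" "n - 1" 3] by simp
    then show "2 ^ (n - 1) * (\<Sum>y\<leftarrow>cs. if y = \<one> then 1 else 2) \<le> r"
      using mult_le_mono2[OF len, of "2 ^ (n - 1)"] r_large by linarith
  qed (use y nilpotent_involution_commutator_power nilp n_pos in simp_all)
  then interpret coset_walk G S h r s c "2 ^ (n - 1) * length ws" .
  interpret W: sided_coset_walk G S h r s c "2 ^ (n - 1) * length ws" K
    by unfold_locales (use K crossing in blast)+
  have "W.crossing = crossing" using crossing(1) by (auto simp: W.crossing_def)
  then show thesis using W.consecutive_crossings_segment \<open>crossing i0\<close> that by metis
qed

lemma commuting_translate_in_component:
  assumes g: "g \<in> S - {h}" and comm: "g \<otimes> h = h \<otimes> g"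
  shows "h \<otimes> g \<in> component g"
proof -
  have g_nbhd: "g \<in> nbhd E H" and hg_nbhd: "h \<otimes> g \<in> nbhd E H"
    using g by (auto simp: nbhd_iff)
  have "E \<one> g" "E g (h \<otimes> g)" "E (h \<otimes> g) h" "E h \<one>"
    using g h_S adjI[of \<one> g] adjI[of g h] adj_sym[OF adjI[of h g]] adj_sym[OF adjI[of \<one> h]]
    by (auto simp: comm)
  then have "(E ^^ 1) \<one> g" "(E ^^ 2) (h \<otimes> g) \<one>" by (auto simp: numeral_2_eq_2)
  moreover have "(2::nat) ^ 2 \<le> r"
    by (rule order_trans[OF power_increasing r_large]) simp_all
  then have "1 + 2 < r" by simp
  ultimately have edge: "{g, h \<otimes> g} \<in> ball_edges E r \<one>"
    using ball_edgeI \<open>E g (h \<otimes> g)\<close> by metis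
  have "same_comp E r \<one> H g g"
    using ball_edge_subset_verts[OF edge] g_nbhd by (intro same_comp_refl) (auto simp: nbhd_def)
  then have "same_comp E r \<one> H g (h \<otimes> g)"
    using hg_nbhd by (intro same_comp_step[OF _ edge]) (auto simp: nbhd_def)
  then show ?thesis using g_nbhd hg_nbhd by (auto simp: component_def conn_adj_def)
qed

lemma noncommuting_translate_in_component:
  assumes g: "g \<in> S - {h}" and noncomm: "g \<otimes> h \<noteq> h \<otimes> g"
  shows "h \<otimes> g \<in> component g"
proof (rule ccontr)
  assume separated: "h \<otimes> g \<notin> component g"
  have g_carrier [simp]: "g \<in> carrier G" using g by simp
  define s where "s i = (if even i then inv g else g)" for i :: nat
  define crossing
    where "crossing i \<longleftrightarrow> (h \<otimes> s (Suc i) \<in> component g) \<noteq> (s (Suc i) \<in> component g)" for i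
  have crossing_even: "crossing i" if "even i" for i
    using separated that by (simp add: crossing_def s_def)
  obtain i j where ij: "i < j" "crossing i" "crossing j" "\<And>k. i < k \<Longrightarrow> k < j \<Longrightarrow> \<not> crossing k"
    and segment: "word_prod (map (\<lambda>i. s i \<otimes> h) [Suc i..<Suc j]) \<in> H"
  proof (rule commutator_walk_segment[of s "[inv g, g]" "\<lambda>_. h" "[h, h]" g "component g" crossing 0])
    show "s i = [inv g, g] ! (i mod length [inv g, g])" "h = [h, h] ! (i mod length [inv g, g])" for i
      by (simp_all add: s_def mod_2_eq_odd flip: numeral_2_eq_2)
    show "comp_closed (component g)" using g generator_in_nbhd component_closed by blast
    show "crossing i \<longleftrightarrow> (h \<otimes> inv s i \<in> component g) \<noteq> (s (Suc i) \<in> component g)"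
      "crossing i \<longleftrightarrow> (h \<otimes> (h \<otimes> inv s i) \<in> component g) \<noteq> (h \<otimes> s (Suc i) \<in> component g)" for i
      by (cases "even i"; simp add: crossing_def s_def eq_commute)+
  qed (use g inv_in_generators crossing_even in \<open>simp_all add: m_assoc\<close>)
  show False
  proof (cases "crossing (Suc i)")
    case True
    then have "j = i + 1" by (intro first_index_unique[where P = crossing, OF ij(1,3,4)]) simp_all
    then have "s j \<otimes> h \<in> H" using segment by (simp add: s_def)
    moreover have "s j \<in> S - {h}" using g inv_in_generators by (simp add: s_def)
    ultimately show False
      using generator_notin_H subgroup_mult_mem_iff[OF H_subgroup, of "s j" h] by auto
  next
    case False
    then have "even i" using crossing_even[of "Suc i"] even_Suc by blast
    then have "j = i + 2"
      using False crossing_even by (intro first_index_unique[where P = crossing, OF ij(1,3,4)])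
        (auto simp: less_2_cases_iff)
    then have "g \<otimes> h \<otimes> inv g \<otimes> h \<in> H" using segment \<open>even i\<close> by (simp add: s_def m_assoc)
    then have "g \<otimes> h \<otimes> inv g \<in> H"
      using subgroup_mult_mem_iff[OF H_subgroup, of "g \<otimes> h \<otimes> inv g" h] by simp
    then show False using conj_h_in_H_iff noncomm by simp
  qed
qed

lemma translate_in_component: "g \<in> S - {h} \<Longrightarrow> h \<otimes> g \<in> component g"
  using commuting_translate_in_component noncommuting_translate_in_component by blast

lemma translate_in_component_iff:
  assumes "t \<in> H" "g \<in> S - {h}"
  shows "t \<otimes> g \<in> component a \<longleftrightarrow> g \<in> component a"
proof (cases "t = \<one>")
  case False
  then show ?thesis
    using assms translate_in_component component_trans component_sym by blast
qed (use assms in simp)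

lemma commutator_walk_component_segment:
  fixes ws cs :: "'a list"
  assumes s: "\<And>i. s i = ws ! (i mod length ws)" and c: "\<And>i. c i = cs ! (i mod length ws)"
    and ws: "ws \<noteq> []" "set ws \<subseteq> S - {h}" and cs: "length cs = length ws" "set cs \<subseteq> H"
    and y: "y \<in> carrier G" "word_prod (map2 (\<otimes>) ws cs) = inv y \<otimes> h \<otimes> y \<otimes> h"
    and len: "(\<Sum>y\<leftarrow>cs. if y = \<one> then 1 else 2 :: nat) \<le> 8"
    and a: "a \<in> S - {h}"
    and crossing: "\<And>i. crossing i \<longleftrightarrow> (inv s i \<in> component a) \<noteq> (s (Suc i) \<in> component a)"
    and "crossing i0"
  obtains i j where "i < j" "crossing i" "crossing j" "\<And>k. i < k \<Longrightarrow> k < j \<Longrightarrow> \<not> crossing k"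
    "word_prod (map (\<lambda>i. s i \<otimes> c i) [Suc i..<Suc j]) \<in> H"
proof -
  have "i mod length ws < length ws" for i using ws(1) by simp
  then have s_S: "s i \<in> S - {h}" and c_mem: "c i \<in> H" for i
    using nth_mem ws(2) cs unfolding s c by (metis subsetD)+
  have spacer_irrelevant: "c i \<otimes> inv s i \<in> component a \<longleftrightarrow> inv s i \<in> component a"
    "h \<otimes> (c i \<otimes> inv s i) \<in> component a \<longleftrightarrow> inv s i \<in> component a"
    "h \<otimes> s i \<in> component a \<longleftrightarrow> s i \<in> component a" for i
    using c_mem[of i] translate_in_component_iff[OF _ inv_in_generators[OF s_S[of i]]]
      translate_in_component_iff[OF _ s_S[of i]] inv_in_generators[OF s_S[of i]]
    by (elim insertE; simp)+
  show thesis
  proof (rule commutator_walk_segment[OF s c ws cs y len component_closed[OF generator_in_nbhd[OF a]]])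
    show "crossing i \<longleftrightarrow> (c i \<otimes> inv s i \<in> component a) \<noteq> (s (Suc i) \<in> component a)"
      "crossing i \<longleftrightarrow> (h \<otimes> (c i \<otimes> inv s i) \<in> component a) \<noteq> (h \<otimes> s (Suc i) \<in> component a)" for i
      unfolding spacer_irrelevant by (rule crossing)+
    show "crossing i0" by fact
  qed (rule that)
qed

lemma separated_generators_commute:
  assumes a: "a \<in> S - {h}" and b: "b \<in> S - {h}" and separated: "a \<notin> component b"
  shows "a \<otimes> h = h \<otimes> a \<or> b \<otimes> h = h \<otimes> b"
proof -
  have [simp]: "a \<in> carrier G" "b \<in> carrier G" using a b by auto
  define s c where "s i = [inv b, a, inv a, b] ! (i mod 4)" and "c i = [\<one>, h, \<one>, h] ! (i mod 4)"
    for i :: nat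
  define crossing where "crossing i \<longleftrightarrow> (inv s i \<in> component b) \<noteq> (s (Suc i) \<in> component b)" for i
  have crossing_iff: "crossing i \<longleftrightarrow> i mod 4 \<in> {0, 2}" for i
  proof -
    have "i mod 4 < 4" by simp
    then consider "i mod 4 = 0" | "i mod 4 = 1" | "i mod 4 = 2" | "i mod 4 = 3" by linarith
    then show ?thesis using separated by cases (simp_all add: crossing_def s_def mod_Suc)
  qed
  obtain i j where ij: "i < j" "crossing i" "crossing j" "\<And>k. i < k \<Longrightarrow> k < j \<Longrightarrow> \<not> crossing k"
    and segment: "word_prod (map (\<lambda>i. s i \<otimes> c i) [Suc i..<Suc j]) \<in> H"
  proof (rule commutator_walk_component_segment[of s "[inv b, a, inv a, b]" c "[\<one>, h, \<one>, h]"
        "inv a \<otimes> b" b crossing 0])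
    show "set [inv b, a, inv a, b] \<subseteq> S - {h}" using a b inv_in_generators by simp
    show "crossing i \<longleftrightarrow> (inv s i \<in> component b) \<noteq> (s (Suc i) \<in> component b)" for i
      by (rule crossing_def)
  qed (use b crossing_iff in \<open>simp_all add: s_def c_def m_assoc inv_mult_group\<close>)
  have i: "i mod 4 = 0 \<or> i mod 4 = 2" using ij(2) crossing_iff by simp
  then have "j = i + 2"
    by (intro first_index_unique[where P = crossing, OF ij(1,3,4)])
      (auto simp: crossing_iff mod_Suc less_2_cases_iff)
  then have "a \<otimes> h \<otimes> inv a \<in> H \<or> b \<otimes> h \<otimes> inv b \<in> H"
    using segment i by (auto simp: s_def c_def mod_Suc m_assoc)
  then show ?thesis by (simp add: conj_h_in_H_iff del: insert_iff)
qed

definition conjugation_word :: "'a \<Rightarrow> 'a \<Rightarrow> 'a list" where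
  "conjugation_word g x = [g, inv x, inv g, g, x, inv g]"

lemma conjugation_word_crossing_iff:
  fixes g x :: 'a
  defines "s \<equiv> \<lambda>i. conjugation_word g x ! (i mod 6)"
  assumes "g \<in> S" "x \<in> S" "inv g \<in> component g" "x \<notin> component g"
  shows "(inv s i \<in> component g) \<noteq> (s (Suc i) \<in> component g) \<longleftrightarrow>
    i mod 6 \<in> (if inv x \<in> component g then {1, 3} else {0, 1, 3, 4})"
proof -
  have "i mod 6 < 6" by simp
  then consider "i mod 6 = 0" | "i mod 6 = 1" | "i mod 6 = 2" | "i mod 6 = 3" | "i mod 6 = 4"
    | "i mod 6 = 5" by linarith
  then show ?thesis using assms by cases (simp_all add: s_def conjugation_word_def mod_Suc)
qed

lemma conjugation_walk_segment:
  assumes g: "g \<in> S - {h}" "inv g \<in> component g" and x: "x \<in> S - {h}" "x \<notin> component g"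
  shows "inv g \<otimes> h \<otimes> g \<in> H \<or> x \<otimes> (inv g \<otimes> h \<otimes> g) \<otimes> inv x \<in> H"
proof -
  have [simp]: "g \<in> carrier G" "x \<in> carrier G" using g x by auto
  define s where "s i = conjugation_word g x ! (i mod 6)" for i
  define c where "c i = [\<one>, \<one>, h, \<one>, \<one>, h] ! (i mod 6)" for i :: nat
  define crossing where "crossing i \<longleftrightarrow> (inv s i \<in> component g) \<noteq> (s (Suc i) \<in> component g)" for i
  have crossing_iff:
    "crossing i \<longleftrightarrow> i mod 6 \<in> (if inv x \<in> component g then {1, 3} else {0, 1, 3, 4})" for i
    unfolding crossing_def s_def by (rule conjugation_word_crossing_iff) (use g x in auto)
  obtain i j where ij: "i < j" "crossing i" "crossing j" "\<And>k. i < k \<Longrightarrow> k < j \<Longrightarrow> \<not> crossing k"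
    and segment: "word_prod (map (\<lambda>i. s i \<otimes> c i) [Suc i..<Suc j]) \<in> H"
  proof (rule commutator_walk_component_segment[of s "conjugation_word g x" c "[\<one>, \<one>, h, \<one>, \<one>, h]"
        "g \<otimes> x \<otimes> inv g" g crossing 1])
    show "set (conjugation_word g x) \<subseteq> S - {h}"
      using g x inv_in_generators by (simp add: conjugation_word_def)
    show "crossing i \<longleftrightarrow> (inv s i \<in> component g) \<noteq> (s (Suc i) \<in> component g)" for i
      by (rule crossing_def)
  qed (use g crossing_iff in \<open>simp_all add: s_def c_def conjugation_word_def m_assoc inv_mult_group\<close>)
  define w where "w = word_prod (map (\<lambda>i. s i \<otimes> c i) [Suc i..<Suc j])"
  consider "i mod 6 = 0" "j = i + 1" | "i mod 6 = 3" "j = i + 1"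
    | "i mod 6 = 1" "j = i + 2" | "i mod 6 = 4" "j = i + 2" | "i mod 6 = 3" "j = i + 4"
    using consecutive_mod_6_cases[OF ij(1), of "if inv x \<in> component g then {1, 3} else {0, 1, 3, 4}"]
      ij(2-4) unfolding crossing_iff by (auto split: if_splits)
  then have "w = inv x \<or> w = x \<or> w = inv g \<otimes> h \<otimes> g \<or> w = x \<otimes> (inv g \<otimes> h \<otimes> g) \<otimes> inv x"
  proof cases
    case 5
    then have "j = Suc (Suc (Suc (Suc i)))" by simp
    then show ?thesis using 5(1) by (simp add: w_def s_def c_def conjugation_word_def mod_Suc m_assoc)
  qed (simp_all add: w_def s_def c_def conjugation_word_def mod_Suc m_assoc)
  moreover have "x \<notin> H" "inv x \<notin> H"
    using generator_notin_H x(1) inv_in_generators by blast+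
  moreover have "w \<in> H" using segment by (simp only: w_def)
  ultimately show ?thesis by metis
qed

lemma generators_in_noncommuting_component:
  assumes g: "g \<in> S - {h}" and noncomm: "g \<otimes> h \<noteq> h \<otimes> g" and x: "x \<in> S - {h}"
  shows "x \<in> component g"
proof (rule ccontr)
  assume x_out: "x \<notin> component g"
  have gx: "g \<in> carrier G" "x \<in> carrier G" using g x by auto
  have x_commutes: "x \<otimes> t = t \<otimes> x" if "t \<in> H" for t
    using separated_generators_commute[OF x g x_out] noncomm gx that by auto
  have "inv g \<in> component g"
    using separated_generators_commute[OF inv_in_generators[OF g] g] noncomm
      inv_commute_iff[OF gx(1) h_carrier] by blast
  then have "inv g \<otimes> h \<otimes> g \<in> H \<or> x \<otimes> (inv g \<otimes> h \<otimes> g) \<otimes> inv x \<in> H"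
    using conjugation_walk_segment g x x_out by blast
  moreover have "inv g \<otimes> h \<otimes> g \<in> H" if "x \<otimes> (inv g \<otimes> h \<otimes> g) \<otimes> inv x \<in> H"
    by (rule conj_mem_imp_mem[OF _ _ _ x_commutes that]) (use gx in auto)
  ultimately have "inv g \<otimes> h \<otimes> g \<in> H" by blast
  then show False
    using conj_h_in_H_iff[of "inv g"] inv_commute_iff[OF gx(1) h_carrier] noncomm gx by simp
qed

lemma generators_commute_if_nbhd_separated:
  assumes "a \<in> nbhd E H" "b \<in> nbhd E H" "\<not> (conn_adj E r \<one> h)\<^sup>*\<^sup>* a b"
    and g: "g \<in> S - {h}"
  shows "g \<otimes> h = h \<otimes> g"
proof (rule ccontr)
  assume "g \<otimes> h \<noteq> h \<otimes> g"
  then have "nbhd E H \<subseteq> component g"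
    using generators_in_noncommuting_component[OF g] translate_in_component_iff
    unfolding nbhd_iff subset_iff by blast
  then have "b \<in> component a" using assms(1,2) component_sym component_trans by blast
  then show False using assms(3) by (simp add: component_def)
qed

end

theorem theorem6p3:
  fixes G :: "('a, 'b) monoid_scheme" and S :: "'a set" and n r :: nat and h :: 'a
  assumes "group G"
    and "1 \<le> n"
    and "nilpotent_le G n"
    and "S \<subseteq> carrier G - {\<one>\<^bsub>G\<^esub>}"
    and "\<forall>s\<in>S. inv\<^bsub>G\<^esub> s \<in> S"
    and "generate G S = carrier G"
    and "2 ^ (n + 2) \<le> r" and "10 \<le> r"
    and "h \<in> S"
    and "local_2_separator (cay_adj G S) r \<one>\<^bsub>G\<^esub> h"
    and "\<forall>v\<in>carrier G. \<not> local_cutvertex (cay_adj G S) r v"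
    and "h \<otimes>\<^bsub>G\<^esub> h = \<one>\<^bsub>G\<^esub>"
  shows "generate G {h} \<lhd> G"
proof -
  interpret group G by fact
  interpret nilpotent_cayley G S h r n
    by unfold_locales (use assms in auto)
  have "s \<otimes>\<^bsub>G\<^esub> h = h \<otimes>\<^bsub>G\<^esub> s" if "s \<in> S" for s
    using assms(10) generators_commute_if_nbhd_separated[of _ _ s] that
    unfolding local_2_separator_def by (cases "s = h") auto
  then have central: "x \<otimes>\<^bsub>G\<^esub> h = h \<otimes>\<^bsub>G\<^esub> x" if "x \<in> carrier G" for x
    using generate_commute[of S h x] assms(4,6) that by (simp add: subset_Diff_insert)
  show ?thesis
    by (rule normal_generateI) (auto simp: central m_assoc)
qed

end
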